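(* Let $n,k\ge 1$ be integers and let $\sigma\in C_k\wr S_n$ have cycle type $\lambda(\sigma)=(\lambda_1,\ldots,\lambda_s)$ and associated cycle products $(t_1,\ldots,t_s)$. Then, as formal power series in $x$ over $\mathbb{C}$, $$\sum_{r\ge 0} \chi_r(\sigma)\,x^r = \frac{1}{(1-t_1x^{\lambda_1})\cdots(1-t_sx^{\lambda_s})}.$$
   Context: For integers $k,n\ge 1$, the generalised symmetric group $C_k \wr S_n$ is regarded as the subgroup of $GL_n(\mathbb{C})$ consisting of the matrices with exactly one non-zero entry in each row and each column, all of whose non-zero entries are $k$-th roots of unity. Let $V=\mathbb{C}^n$ be its natural representation, and for each integer $r\ge 0$ let $\chi_r$ be the character of $C_k\wr S_n$ on $\mathrm{Sym}^r V$. For $\sigma\in C_k\wr S_n$, let $|\sigma|\in S_n$ be the permutation whose permutation matrix is obtained from $\sigma$ by replacing every non-zero entry by $1$; $\lambda(\sigma)=(\lambda_1,\ldots,\lambda_s)$ is the cycle type of $|\sigma|$ (cycles of equal length being ordered by the minimum of their supports), and $t_i\in\mathbb{C}$ is the product of the non-zero entries of $\sigma$ corresponding to the $i$-th cycle (of length $\lambda_i$) of $|\sigma|$. *)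

theory Defs
  imports
    Complex_Main
    "HOL-Library.Poly_Mapping"
    "HOL-Combinatorics.Orbits"
    "HOL-Computational_Algebra.Formal_Power_Series"
    "Jordan_Normal_Form.Matrix"
begin

section \<open>The generalised symmetric group\<close>

text \<open>Rows and columns are indexed by \<open>0, \<dots>, n - 1\<close>, as usual for \<^typ>\<open>'a mat\<close>.\<close>

definition gen_sym_group :: "nat \<Rightarrow> nat \<Rightarrow> complex mat set" where
  "gen_sym_group k n = {A \<in> carrier_mat n n.
     (\<forall>i<n. \<exists>!j. j < n \<and> A $$ (i, j) \<noteq> 0) \<and>
     (\<forall>j<n. \<exists>!i. i < n \<and> A $$ (i, j) \<noteq> 0) \<and>
     (\<forall>i<n. \<forall>j<n. A $$ (i, j) \<noteq> 0 \<longrightarrow> A $$ (i, j) ^ k = 1)}"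

text \<open>The matrix of the linear map \<open>e\<^sub>j \<mapsto> e\<^bsub>p j\<^esub>\<close>.\<close>

definition permutation_mat :: "nat \<Rightarrow> (nat \<Rightarrow> nat) \<Rightarrow> complex mat" where
  "permutation_mat n p = mat n n (\<lambda>(i, j). if i = p j then 1 else 0)"

definition underlying_perm :: "complex mat \<Rightarrow> nat \<Rightarrow> nat" where
  "underlying_perm A = (THE p. p permutes {..<dim_row A} \<and>
     permutation_mat (dim_row A) p = map_mat (\<lambda>z. if z = 0 then 0 else 1) A)"

text \<open>
  The supports of the cycles (fixed points included), longest first. Each cycle is listed at the
  position of its minimum and \<^const>\<open>sort_key\<close> is stable, so cycles of equal length are ordered
  by the minimum of their supports.
\<close>

definition cycle_supports :: "complex mat \<Rightarrow> nat set list" where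
  "cycle_supports A =
     sort_key (\<lambda>c. - int (card c))
       (map (orbit (underlying_perm A))
         (filter (\<lambda>i. i = Min (orbit (underlying_perm A) i)) [0..<dim_row A]))"

definition cycle_type :: "complex mat \<Rightarrow> nat list" where
  "cycle_type A = map card (cycle_supports A)"

definition cycle_products :: "complex mat \<Rightarrow> complex list" where
  "cycle_products A =
     map (\<lambda>c. \<Prod>j\<in>c. A $$ (underlying_perm A j, j)) (cycle_supports A)"


section \<open>Trace of an endomorphism of a finite-dimensional subspace\<close>

text \<open>
  The chosen basis is immaterial when \<open>W\<close> is finite-dimensional and \<open>f\<close> is linear and maps \<open>W\<close>
  to itself: see \<open>trace_on_eq\<close> below.
\<close>

definition trace_on ::
    "('a::field \<Rightarrow> 'b::ab_group_add \<Rightarrow> 'b) \<Rightarrow> 'b set \<Rightarrow> ('b \<Rightarrow> 'b) \<Rightarrow> 'a" where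
  "trace_on scale W f =
     (let B = (SOME B. \<not> module.dependent scale B \<and> module.span scale B = W)
      in \<Sum>b\<in>B. module.representation scale B (f b) b)"

context vector_space
begin

lemma trace_basis_independent:
  assumes B: "independent B" "finite B" and C: "independent C" "finite C"
    and span: "span B = span C"
    and lin: "Vector_Spaces.linear scale scale f"
    and f: "\<And>w. w \<in> span B \<Longrightarrow> f w \<in> span B"
  shows "(\<Sum>b\<in>B. representation B (f b) b) = (\<Sum>c\<in>C. representation C (f c) c)"
proof -
  interpret f: Vector_Spaces.linear scale scale f by fact
  have b_exp: "(\<Sum>c\<in>C. scale (representation C b c) c) = b" if "b \<in> span B" for b
    using that C span by (intro sum_representation_eq) auto
  have c_exp: "(\<Sum>b\<in>B. scale (representation B c b) b) = c" if "c \<in> span B" for c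
    using that B span by (intro sum_representation_eq) auto
  have fs: "f w \<in> span C" if "w \<in> span C" for w using f span that by auto
  have inB: "c \<in> span B" if "c \<in> C" for c using that span span_base by auto
  have inC: "b \<in> span C" if "b \<in> B" for b using that span span_base by auto
  have "(\<Sum>b\<in>B. representation B (f b) b)
      = (\<Sum>b\<in>B. \<Sum>c\<in>C. representation C b c * representation B (f c) b)"
  proof (rule sum.cong[OF refl])
    fix b assume b: "b \<in> B"
    have "f b = f (\<Sum>c\<in>C. scale (representation C b c) c)"
      using b_exp[OF span_base[OF b]] by simp
    also have "\<dots> = (\<Sum>c\<in>C. scale (representation C b c) (f c))"
      by (simp add: f.sum f.scale)
    finally have *: "f b = \<dots>" .
    show "representation B (f b) b = (\<Sum>c\<in>C. representation C b c * representation B (f c) b)"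
      unfolding * using B f inB
      by (simp add: representation_sum representation_scale span_scale)
  qed
  also have "\<dots> = (\<Sum>c\<in>C. \<Sum>b\<in>B. representation B (f c) b * representation C b c)"
    by (subst sum.swap) (simp add: mult.commute)
  also have "\<dots> = (\<Sum>c\<in>C. representation C (f c) c)"
  proof (rule sum.cong[OF refl])
    fix c assume c: "c \<in> C"
    have "representation C (f c) c
        = representation C (\<Sum>b\<in>B. scale (representation B (f c) b) b) c"
      using c_exp[OF f[OF inB[OF c]]] by simp
    also have "\<dots> = (\<Sum>b\<in>B. representation B (f c) b * representation C b c)"
      using C inC by (simp add: representation_sum representation_scale span_scale)
    finally show "(\<Sum>b\<in>B. representation B (f c) b * representation C b c)
      = representation C (f c) c" by simp
  qed
  finally show ?thesis .
qed

lemma trace_on_eq: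
  assumes B: "independent B" "finite B" "span B = W"
    and lin: "Vector_Spaces.linear scale scale f" and f: "\<And>w. w \<in> W \<Longrightarrow> f w \<in> W"
  shows "trace_on scale W f = (\<Sum>b\<in>B. representation B (f b) b)"
proof -
  define C where "C = (SOME C. independent C \<and> span C = W)"
  have C: "independent C \<and> span C = W"
    unfolding C_def by (rule someI[of _ B]) (use B in auto)
  have "C \<subseteq> span B" using C B span_superset by auto
  then have "finite C"
    using independent_span_bound[OF B(2)] C by auto
  then show ?thesis
    unfolding trace_on_def C_def[symmetric] Let_def
    using B C lin f by (intro trace_basis_independent) auto
qed

end


section \<open>Symmetric powers of the natural representation\<close>

text \<open>
  The symmetric algebra of \<open>V = \<complex>\<^sup>n\<close> is modelled as the algebra of polynomials in the standard
  basis vectors \<open>e\<^sub>0, \<dots>, e\<^bsub>n-1\<^esub>\<close>; a polynomial maps exponent vectors to coefficients.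
\<close>

type_synonym sym_alg = "(nat \<Rightarrow>\<^sub>0 nat) \<Rightarrow>\<^sub>0 complex"

definition sym_scale :: "complex \<Rightarrow> sym_alg \<Rightarrow> sym_alg" where
  "sym_scale c p = Poly_Mapping.single 0 c * p"

interpretation sym: vector_space sym_scale
  by unfold_locales
    (auto simp: sym_scale_def algebra_simps single_add mult_single simp flip: mult.assoc)

text \<open>The inclusion of \<open>V\<close> in its symmetric algebra.\<close>

definition sym_incl :: "complex vec \<Rightarrow> sym_alg" where
  "sym_incl v = (\<Sum>i<dim_vec v. sym_scale (v $ i) (Poly_Mapping.single (Poly_Mapping.single i 1) 1))"

definition Sym_power :: "nat \<Rightarrow> nat \<Rightarrow> sym_alg set" where
  "Sym_power n r = {p. \<forall>m\<in>Poly_Mapping.keys p.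
     Poly_Mapping.keys m \<subseteq> {..<n} \<and> (\<Sum>i\<in>Poly_Mapping.keys m. Poly_Mapping.lookup m i) = r}"

text \<open>
  The algebra endomorphism induced by \<open>A\<close>, i.e. the one with \<open>e\<^sub>j \<mapsto> A e\<^sub>j\<close>; the vector
  \<open>A e\<^sub>j\<close> is the \<open>j\<close>-th column of \<open>A\<close>.
\<close>

definition sym_act :: "complex mat \<Rightarrow> sym_alg \<Rightarrow> sym_alg" where
  "sym_act A p = (\<Sum>m\<in>Poly_Mapping.keys p. sym_scale (Poly_Mapping.lookup p m)
     (\<Prod>j\<in>Poly_Mapping.keys m. sym_incl (col A j) ^ Poly_Mapping.lookup m j))"

lemma poly_mapping_sum_single:
  fixes p :: "'a \<Rightarrow>\<^sub>0 'b::comm_monoid_add"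
  shows "p = (\<Sum>m\<in>Poly_Mapping.keys p. Poly_Mapping.single m (Poly_Mapping.lookup p m))"
  by (rule poly_mapping_eqI)
    (auto simp: lookup_sum lookup_single when_def in_keys_iff sum.delta)

lemma lookup_sym_scale: "Poly_Mapping.lookup (sym_scale c p) m = c * Poly_Mapping.lookup p m"
  by (simp add: sym_scale_def Poly_Mapping.map.rep_eq when_def flip: mult_map_scale_conv_mult)

lemma sym_scale_mult: "sym_scale c p * sym_scale d q = sym_scale (c * d) (p * q)"
  by (simp add: sym_scale_def mult_single[of 0 c 0 d, simplified, symmetric] algebra_simps)

lemma sym_act_superset:
  assumes "finite S" "Poly_Mapping.keys p \<subseteq> S"
  shows "sym_act A p = (\<Sum>m\<in>S. sym_scale (Poly_Mapping.lookup p m)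
     (\<Prod>j\<in>Poly_Mapping.keys m. sym_incl (col A j) ^ Poly_Mapping.lookup m j))"
  unfolding sym_act_def using assms
  by (intro sum.mono_neutral_left) (auto simp: in_keys_iff)

lemma linear_sym_act: "Vector_Spaces.linear sym_scale sym_scale (sym_act A)"
proof unfold_locales
  fix p q :: sym_alg and c :: complex
  let ?S = "Poly_Mapping.keys p \<union> Poly_Mapping.keys q"
  have "Poly_Mapping.keys (p + q) \<subseteq> ?S" by (rule keys_add)
  then show "sym_act A (p + q) = sym_act A p + sym_act A q"
    by (simp add: sym_act_superset[of ?S] lookup_add sym.scale_left_distrib sum.distrib)
  have "Poly_Mapping.keys (sym_scale c p) \<subseteq> Poly_Mapping.keys p"
    by (auto simp: in_keys_iff lookup_sym_scale)
  then show "sym_act A (sym_scale c p) = sym_scale c (sym_act A p)"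
    by (simp add: sym_act_superset[of "Poly_Mapping.keys p"] lookup_sym_scale sym.scale_sum_right)
qed

interpretation sym_act: Vector_Spaces.linear sym_scale sym_scale "sym_act A" for A
  by (rule linear_sym_act)

lemma sym_act_single:
  "sym_act A (Poly_Mapping.single m c) =
     sym_scale c (\<Prod>j\<in>Poly_Mapping.keys m. sym_incl (col A j) ^ Poly_Mapping.lookup m j)"
  by (simp add: sym_act_superset[of "{m}"])

lemma sym_act_one: "sym_act A 1 = 1"
  unfolding single_one[symmetric] sym_act_single by simp

lemma sym_act_mult: "sym_act A (p * q) = sym_act A p * sym_act A q"
proof -
  define E where "E m = (\<Prod>j\<in>Poly_Mapping.keys m. sym_incl (col A j) ^ Poly_Mapping.lookup m j)"
    for m :: "nat \<Rightarrow>\<^sub>0 nat"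
  have E_sup: "E m = (\<Prod>j\<in>S. sym_incl (col A j) ^ Poly_Mapping.lookup m j)"
    if "finite S" "Poly_Mapping.keys m \<subseteq> S" for S m
    unfolding E_def using that by (intro prod.mono_neutral_left) (auto simp: in_keys_iff)
  have E_add: "E (m + l) = E m * E l" for m l
  proof -
    let ?S = "Poly_Mapping.keys m \<union> Poly_Mapping.keys l"
    have "Poly_Mapping.keys (m + l) \<subseteq> ?S" by (rule keys_add)
    then show ?thesis
      by (simp add: E_sup[of ?S] lookup_add power_add prod.distrib)
  qed
  have single: "sym_act A (Poly_Mapping.single m c * Poly_Mapping.single l d)
      = sym_act A (Poly_Mapping.single m c) * sym_act A (Poly_Mapping.single l d)" for m l c d
    by (simp add: mult_single sym_act_single sym_scale_mult E_add flip: E_def)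
  show ?thesis
    by (subst (1 2) poly_mapping_sum_single[of p], subst (1 2) poly_mapping_sum_single[of q])
      (simp only: sum_product sym_act.sum single)
qed

lemma sym_act_incl:
  assumes "A \<in> carrier_mat n n" "v \<in> carrier_vec n"
  shows "sym_act A (sym_incl v) = sym_incl (A *\<^sub>v v)"
proof -
  define x where "x i = (Poly_Mapping.single (Poly_Mapping.single i (Suc 0)) 1 :: sym_alg)" for i :: nat
  have "sym_act A (x j) = sym_incl (col A j)" for j
    unfolding x_def sym_act_single by simp
  then have "sym_act A (sym_incl v) = (\<Sum>j<n. \<Sum>i<n. sym_scale (v $ j * A $$ (i, j)) (x i))"
    using assms by (simp add: sym_incl_def sym_act.sum sym_act.scale sym.scale_sum_right flip: x_def)
  also have "\<dots> = (\<Sum>i<n. \<Sum>j<n. sym_scale (A $$ (i, j) * v $ j) (x i))"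
    by (subst sum.swap) (simp add: mult.commute)
  also have "\<dots> = sym_incl (A *\<^sub>v v)"
    using assms
    by (simp add: sym_incl_def scalar_prod_def sym.scale_sum_left lessThan_atLeast0 flip: x_def)
  finally show ?thesis .
qed

definition sym_char :: "nat \<Rightarrow> nat \<Rightarrow> complex mat \<Rightarrow> complex" where
  "sym_char n r A = trace_on sym_scale (Sym_power n r) (sym_act A)"

end

theory Submission
  imports Defs
begin

text \<open>
  If \<open>\<sigma> e\<^sub>j = a\<^sub>j e\<^bsub>p j\<^esub>\<close>, then \<open>\<sigma>\<close> sends each monomial of \<open>Sym\<^sup>r V\<close> to a multiple of a monomial, so
  only the monomials fixed by \<open>p\<close> contribute to the trace. These are the monomials whose exponents
  are constant on the cycles of \<open>p\<close>, and one with exponent \<open>u c\<close> on each cycle \<open>c\<close> has degree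
  \<open>\<Sum>c. |c| * u c\<close> and eigenvalue \<open>\<Prod>c. (t c) ^ u c\<close>. The generating function of these weights is
  the product of the geometric series \<open>1 / (1 - t c * x ^ |c|)\<close>.
\<close>

section \<open>Generating functions of weighted exponent vectors\<close>

definition weighted_exponents :: "'c set \<Rightarrow> ('c \<Rightarrow> nat) \<Rightarrow> nat \<Rightarrow> ('c \<Rightarrow> nat) set" where
  "weighted_exponents D l r = {u. (\<forall>c. c \<notin> D \<longrightarrow> u c = 0) \<and> (\<Sum>c\<in>D. l c * u c) = r}"

text \<open>A positive weight gives \<open>u c <= l c * u c <= r\<close>, so each exponent on the
  finite set \<open>D\<close> has finitely many possible values.\<close>

lemma finite_weighted_exponents:
  assumes "finite D" and pos: "\<And>c. c \<in> D \<Longrightarrow> 0 < l c"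
  shows "finite (weighted_exponents D l r)"
proof (rule finite_subset)
  show "weighted_exponents D l r \<subseteq> {u. \<forall>c. (c \<in> D \<longrightarrow> u c \<in> {..r}) \<and> (c \<notin> D \<longrightarrow> u c = 0)}"
  proof -
    have "u c \<le> (\<Sum>c\<in>D. l c * u c)" if "c \<in> D" for u c
    proof -
      have "u c \<le> l c * u c" using pos[OF that] by simp
      also have "\<dots> \<le> (\<Sum>c\<in>D. l c * u c)"
        by (rule member_le_sum) (use that assms in auto)
      finally show ?thesis .
    qed
    then show ?thesis by (auto simp: weighted_exponents_def)
  qed
  show "finite {u. \<forall>c. (c \<in> D \<longrightarrow> u c \<in> {..r}) \<and> (c \<notin> D \<longrightarrow> u c = (0::nat))}"
    using assms by (intro finite_set_of_finite_funs) auto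
qed

text \<open>
  The case split is on whether \<open>u c\<close> vanishes; it yields the recurrence \<open>F (insert c D) =
  F D + t c * x ^ l c * F (insert c D)\<close> for the generating functions.
\<close>

lemma weighted_exponents_insert:
  assumes "finite D" "c \<notin> D"
  shows "weighted_exponents (insert c D) l r = weighted_exponents D l r \<union>
    (if r < l c then {} else (\<lambda>u. u(c := Suc (u c))) ` weighted_exponents (insert c D) l (r - l c))"
    (is "?L = ?R \<union> ?S")
proof (intro equalityI subsetI)
  have upd: "(\<Sum>d\<in>D. l d * (u(c := x)) d) = (\<Sum>d\<in>D. l d * u d)" for u x
    using assms by (intro sum.cong) auto
  {
    fix u assume u: "u \<in> ?L"
    show "u \<in> ?R \<union> ?S"
    proof (cases "u c")
      case 0
      then have "u \<in> ?R" using u assms by (simp add: weighted_exponents_def) metis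
      then show ?thesis ..
    next
      case (Suc k)
      \<comment> \<open>With \<open>r\<close> written as a sum, subtracting \<open>l c\<close> is
        not truncated and leaves exactly the degree of \<open>u(c := k)\<close>.\<close>
      have "r = l c * Suc k + (\<Sum>d\<in>D. l d * u d)"
        using u assms Suc by (simp add: weighted_exponents_def)
      moreover have "u(c := k) \<in> weighted_exponents (insert c D) l (l c * k + (\<Sum>d\<in>D. l d * u d))"
        using u assms upd[of u k] by (simp add: weighted_exponents_def)
      ultimately have "\<not> r < l c" "u(c := k) \<in> weighted_exponents (insert c D) l (r - l c)"
        by auto
      moreover have "u = (u(c := k))(c := Suc ((u(c := k)) c))" using Suc by auto
      ultimately have "u \<in> ?S" by (simp only: if_False) (rule image_eqI)
      then show ?thesis ..
    qed
  next
    fix u assume "u \<in> ?R \<union> ?S"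
    then show "u \<in> ?L"
    proof
      assume "u \<in> ?R"
      then show ?thesis using assms by (auto simp: weighted_exponents_def)
    next
      assume "u \<in> ?S"
      then obtain v where "\<not> r < l c" "v \<in> weighted_exponents (insert c D) l (r - l c)"
        and u: "u = v(c := Suc (v c))" by (auto split: if_splits)
      then show ?thesis using assms upd[of v "Suc (v c)"] unfolding u
        by (simp add: weighted_exponents_def) linarith
    qed
  }
qed

text \<open>The product form makes sense over every commutative ring, without inverses of power
  series. Since \<open>l\<close> is positive on \<open>D\<close>, every coefficient is a finite
  sum.\<close>

lemma fps_weighted_exponents:
  fixes t :: "'c \<Rightarrow> 'a::comm_ring_1"
  assumes "finite D" "\<And>c. c \<in> D \<Longrightarrow> 0 < l c"
  shows "Abs_fps (\<lambda>r. \<Sum>u\<in>weighted_exponents D l r. \<Prod>c\<in>D. t c ^ u c) *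
    (\<Prod>c\<in>D. 1 - fps_const (t c) * fps_X ^ l c) = 1"
  using assms
proof (induction D rule: finite_induct)
  case empty
  have "weighted_exponents ({} :: 'c set) l r = (if r = 0 then {\<lambda>_. 0} else {})" for r
    by (auto simp: weighted_exponents_def)
  then show ?case by (auto intro: fps_ext)
next
  case (insert c D)
  define F where "F E = Abs_fps (\<lambda>r. \<Sum>u\<in>weighted_exponents E l r. \<Prod>c\<in>E. t c ^ u c)" for E
  have "F (insert c D) = F D + fps_const (t c) * (F (insert c D) * fps_X ^ l c)"
  proof (rule fps_ext)
    fix r
    let ?W = "weighted_exponents (insert c D) l" and ?f = "\<lambda>u. u(c := Suc (u c))"
    let ?S = "if r < l c then {} else ?f ` ?W (r - l c)"
    let ?w = "\<lambda>u. \<Prod>d\<in>insert c D. t d ^ u d"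
    have fin: "finite (weighted_exponents D l r)" "finite ?S"
      using insert by (auto intro!: finite_weighted_exponents)
    have inj: "inj_on ?f X" for X
      by (rule inj_onI, rule ext) (metis fun_upd_apply old.nat.inject)
    \<comment> \<open>Raising the exponent at \<open>c\<close> by one contributes one further factor
      \<open>t c\<close>.\<close>
    have w: "?w (?f u) = t c * ?w u" for u
    proof -
      have "(\<Prod>d\<in>D. t d ^ (?f u) d) = (\<Prod>d\<in>D. t d ^ u d)"
        using insert by (intro prod.cong) auto
      then show ?thesis using insert by (simp add: mult.assoc)
    qed
    have "fps_nth (F (insert c D)) r = (\<Sum>u\<in>weighted_exponents D l r \<union> ?S. ?w u)"
      unfolding F_def using weighted_exponents_insert[of D c l r] insert by simp
    \<comment> \<open>Members of the first set vanish at \<open>c\<close>, whereas those of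
      \<open>?S\<close> are positive there.\<close>
    also have "\<dots> = (\<Sum>u\<in>weighted_exponents D l r. ?w u) + (\<Sum>u\<in>?S. ?w u)"
      using fin by (rule sum.union_disjoint)
        (use insert in \<open>auto simp: weighted_exponents_def\<close>)
    also have "(\<Sum>u\<in>weighted_exponents D l r. ?w u) = fps_nth (F D) r"
      unfolding F_def using insert by (auto simp: weighted_exponents_def intro!: sum.cong)
    \<comment> \<open>Multiplication by \<open>fps_X ^ l c\<close> shifts coefficients by
      \<open>l c\<close>; below that index the coefficient is 0, matching the empty
      \<open>?S\<close>.\<close>
    also have "(\<Sum>u\<in>?S. ?w u) = fps_nth (fps_const (t c) * (F (insert c D) * fps_X ^ l c)) r"
    proof (cases "r < l c")
      case False
      have "(\<Sum>u\<in>?S. ?w u) = (\<Sum>u\<in>?W (r - l c). t c * ?w u)"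
        using False by (simp only: if_False sum.reindex[OF inj] o_def w)
      then show ?thesis
        using False by (simp add: F_def fps_X_power_mult_right_nth sum_distrib_left)
    qed (simp add: fps_X_power_mult_right_nth)
    finally show "fps_nth (F (insert c D)) r =
      fps_nth (F D + fps_const (t c) * (F (insert c D) * fps_X ^ l c)) r" by simp
  qed
  then have "F (insert c D) * (1 - fps_const (t c) * fps_X ^ l c) = F D"
    by (simp add: algebra_simps)
  moreover have "F D * (\<Prod>c\<in>D. 1 - fps_const (t c) * fps_X ^ l c) = 1"
    unfolding F_def using insert by auto
  ultimately show ?case
    unfolding F_def[symmetric] using insert by (simp add: mult.assoc[symmetric])
qed

section \<open>The monomial basis of the symmetric power and the trace in it\<close>

definition exponents :: "nat \<Rightarrow> nat \<Rightarrow> (nat \<Rightarrow>\<^sub>0 nat) set" where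
  "exponents n r = {m. Poly_Mapping.keys m \<subseteq> {..<n} \<and>
     (\<Sum>i\<in>Poly_Mapping.keys m. Poly_Mapping.lookup m i) = r}"

abbreviation monomial :: "(nat \<Rightarrow>\<^sub>0 nat) \<Rightarrow> sym_alg" where
  "monomial m \<equiv> Poly_Mapping.single m 1"

lemma sum_lookup_superset:
  assumes "finite S" "Poly_Mapping.keys m \<subseteq> S"
  shows "(\<Sum>i\<in>Poly_Mapping.keys m. Poly_Mapping.lookup m i) = (\<Sum>i\<in>S. Poly_Mapping.lookup m i)"
  using assms by (intro sum.mono_neutral_left) (auto simp: in_keys_iff)

lemma exponents_altdef:
  "exponents n r = {m. Poly_Mapping.keys m \<subseteq> {..<n} \<and> (\<Sum>i<n. Poly_Mapping.lookup m i) = r}"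
  unfolding exponents_def using sum_lookup_superset[of "{..<n}"] by auto

text \<open>Via the injective \<open>lookup\<close>, the exponent vectors become functions bounded
  by \<open>r\<close> on \<open>{..<n}\<close> and 0 elsewhere.\<close>

lemma finite_exponents: "finite (exponents n r)"
proof (rule finite_imageD)
  have "Poly_Mapping.lookup m i \<le> (\<Sum>i<n. Poly_Mapping.lookup m i)" if "i < n" for m :: "nat \<Rightarrow>\<^sub>0 nat" and i
    by (rule member_le_sum) (use that in auto)
  then have "Poly_Mapping.lookup ` exponents n r \<subseteq>
      {u. \<forall>i. (i \<in> {..<n} \<longrightarrow> u i \<in> {..r}) \<and> (i \<notin> {..<n} \<longrightarrow> u i = 0)}"
    by (auto simp: exponents_altdef subset_iff in_keys_iff)
  then show "finite (Poly_Mapping.lookup ` exponents n r)"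
    by (rule finite_subset) (intro finite_set_of_finite_funs; simp)
  show "inj_on Poly_Mapping.lookup (exponents n r)"
    by (auto intro!: inj_onI poly_mapping_eqI)
qed

lemma sym_scale_monomial: "sym_scale c (monomial m) = Poly_Mapping.single m c"
  by (simp add: sym_scale_def mult_single)

text \<open>Distinct monomials have disjoint supports, so \<open>lookup\<close> reads off a
  coefficient of a linear combination. This serves both for independence and for coordinates in the
  monomial basis.\<close>

lemma lookup_sum_monomials:
  assumes "finite M" "m \<in> M"
  shows "Poly_Mapping.lookup (\<Sum>b\<in>monomial ` M. sym_scale (c b) b) m = c (monomial m)"
proof -
  have "inj_on monomial M"
    by (auto intro!: inj_onI dest: arg_cong[of _ _ Poly_Mapping.keys])
  then have "(\<Sum>b\<in>monomial ` M. sym_scale (c b) b)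
      = (\<Sum>m\<in>M. Poly_Mapping.single m (c (monomial m)))"
    by (simp add: sum.reindex sym_scale_monomial)
  then show ?thesis
    using assms by (simp add: lookup_sum lookup_single when_def)
qed

lemma independent_monomials:
  assumes "finite M"
  shows "sym.independent (monomial ` M)"
proof (rule sym.independent_if_scalars_zero)
  fix c and b :: sym_alg
  assume "(\<Sum>b\<in>monomial ` M. sym_scale (c b) b) = 0" "b \<in> monomial ` M"
  then show "c b = 0" using lookup_sum_monomials[OF assms, of _ c] by auto
qed (use assms in simp)

lemma span_monomials: "sym.span (monomial ` exponents n r) = Sym_power n r"
proof (rule sym.span_unique)
  show "monomial ` exponents n r \<subseteq> Sym_power n r"
    by (auto simp: exponents_def Sym_power_def)
  show "sym.subspace (Sym_power n r)"
  proof (rule sym.subspaceI)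
    show "p + q \<in> Sym_power n r" if "p \<in> Sym_power n r" "q \<in> Sym_power n r" for p q
      using that keys_add[of p q] unfolding Sym_power_def by blast
    show "sym_scale c p \<in> Sym_power n r" if "p \<in> Sym_power n r" for c p
      using that by (auto simp: Sym_power_def in_keys_iff lookup_sym_scale)
  qed (simp add: Sym_power_def)
  fix S assume S: "monomial ` exponents n r \<subseteq> S" "sym.subspace S"
  show "Sym_power n r \<subseteq> S"
  proof
    fix p assume "p \<in> Sym_power n r"
    then have "sym_scale (Poly_Mapping.lookup p m) (monomial m) \<in> S" if "m \<in> Poly_Mapping.keys p" for m
      using that S by (intro sym.subspace_scale) (auto simp: Sym_power_def exponents_def)
    then have "(\<Sum>m\<in>Poly_Mapping.keys p. sym_scale (Poly_Mapping.lookup p m) (monomial m)) \<in> S"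
      using S by (intro sym.subspace_sum) auto
    then show "p \<in> S"
      by (simp add: sym_scale_monomial flip: poly_mapping_sum_single)
  qed
qed

text \<open>By \<open>trace_on_eq\<close> the trace may be computed in the monomial basis, where
  coordinates are coefficients. Stability is assumed on monomials only and extends to all of
  \<open>Sym_power n r\<close> by linearity.\<close>

lemma sym_char_eq_sum_lookup:
  assumes "\<And>m. m \<in> exponents n r \<Longrightarrow> sym_act A (monomial m) \<in> Sym_power n r"
  shows "sym_char n r A =
    (\<Sum>m\<in>exponents n r. Poly_Mapping.lookup (sym_act A (monomial m)) m)"
proof -
  let ?B = "monomial ` exponents n r"
  have inj: "inj_on monomial (exponents n r)"
    by (auto intro!: inj_onI dest: arg_cong[of _ _ Poly_Mapping.keys])
  have ind: "sym.independent ?B"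
    by (intro independent_monomials finite_exponents)
  have rep: "sym.representation ?B v (monomial m) = Poly_Mapping.lookup v m"
    if "v \<in> Sym_power n r" "m \<in> exponents n r" for v m
  proof -
    have "(\<Sum>b\<in>?B. sym_scale (sym.representation ?B v b) b) = v"
      using that ind by (intro sym.sum_representation_eq) (auto simp: finite_exponents span_monomials)
    then show ?thesis
      using lookup_sum_monomials[OF finite_exponents that(2), of "sym.representation ?B v"] by simp
  qed
  have "sym_act A ` sym.span ?B = sym.span (sym_act A ` ?B)"
    by (simp add: sym_act.span_image)
  also have "\<dots> \<subseteq> sym.span (Sym_power n r)"
    using assms by (intro sym.span_mono) auto
  also have "\<dots> = Sym_power n r"
    unfolding span_monomials[symmetric] by (rule sym.span_span)
  finally have stable: "sym_act A w \<in> Sym_power n r" if "w \<in> Sym_power n r" for w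
    using that by (auto simp: span_monomials)
  have "sym_char n r A = (\<Sum>b\<in>?B. sym.representation ?B (sym_act A b) b)"
    unfolding sym_char_def
    by (rule sym.trace_on_eq)
      (use ind stable in \<open>auto simp: finite_exponents span_monomials linear_sym_act\<close>)
  also have "\<dots> = (\<Sum>m\<in>exponents n r. Poly_Mapping.lookup (sym_act A (monomial m)) m)"
    unfolding sum.reindex[OF inj] by (auto intro!: sum.cong rep assms)
  finally show ?thesis .
qed

section \<open>Action of a monomial matrix on monomials\<close>

lemma single_power:
  fixes c :: "'a::comm_semiring_1"
  shows "Poly_Mapping.single (Poly_Mapping.single i 1 :: 'b \<Rightarrow>\<^sub>0 nat) c ^ k =
    Poly_Mapping.single (Poly_Mapping.single i k) (c ^ k)"
  by (induction k) (simp_all add: mult_single flip: single_add)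

lemma prod_single:
  fixes c :: "'i \<Rightarrow> 'a::comm_semiring_1" and m :: "'i \<Rightarrow> 'b::comm_monoid_add"
  shows "(\<Prod>j\<in>S. Poly_Mapping.single (m j) (c j)) = Poly_Mapping.single (\<Sum>j\<in>S. m j) (\<Prod>j\<in>S. c j)"
  by (induction S rule: infinite_finite_induct) (simp_all add: mult_single)

text \<open>The zero pattern says that column \<open>j\<close> of \<open>A\<close> is a multiple of
  the basis vector with index \<open>p j\<close>. Keeping \<open>p\<close> a parameter separates the
  computation from the description of \<open>underlying_perm\<close>.\<close>

locale monomial_matrix =
  fixes n :: nat and A :: "complex mat" and p :: "nat \<Rightarrow> nat"
  assumes carrier: "A \<in> carrier_mat n n"
    and perm: "p permutes {..<n}"
    and entries: "\<And>i j. i < n \<Longrightarrow> j < n \<Longrightarrow> i \<noteq> p j \<Longrightarrow> A $$ (i, j) = 0"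
begin

definition a :: "nat \<Rightarrow> complex" where "a j = A $$ (p j, j)"

lemma p_less: "j < n \<Longrightarrow> p j < n"
  using permutes_in_image[OF perm, of j] by simp

lemma permutation_p: "permutation p"
  using perm permutation_permutes by blast

lemma sym_incl_col:
  assumes "j < n"
  shows "sym_incl (col A j) = Poly_Mapping.single (Poly_Mapping.single (p j) 1) (a j)"
proof -
  have "sym_scale (col A j $ i) (monomial (Poly_Mapping.single i 1)) =
      (if i = p j then Poly_Mapping.single (Poly_Mapping.single (p j) 1) (a j) else 0)"
    if "i < n" for i
    using carrier assms that entries[of i j] unfolding sym_scale_monomial by (simp add: a_def)
  then have "sym_incl (col A j) =
      (\<Sum>i<n. if i = p j then Poly_Mapping.single (Poly_Mapping.single (p j) 1) (a j) else 0)"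
    unfolding sym_incl_def using carrier by (intro sum.cong) auto
  then show ?thesis using p_less[OF assms] by simp
qed

text \<open>The exponent of variable \<open>j\<close> moves to variable \<open>p j\<close>, so the
  new exponent at \<open>q\<close> is the old one at \<open>inv p q\<close>; \<open>map_key\<close>
  expresses this composition. Indices outside the keys contribute a factor
  \<open>a j ^ 0 = 1\<close>.\<close>

lemma sym_act_monomial:
  assumes "Poly_Mapping.keys m \<subseteq> {..<n}"
  shows "sym_act A (monomial m) =
    Poly_Mapping.single (Poly_Mapping.map_key (Hilbert_Choice.inv p) m) (\<Prod>j<n. a j ^ Poly_Mapping.lookup m j)"
proof -
  have bij: "bij p" "inj p" "surj p" "inj (Hilbert_Choice.inv p)"
    using permutes_bij[OF perm] by (auto simp: bij_def surj_imp_inj_inv)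
  have "(\<Sum>j\<in>Poly_Mapping.keys m. Poly_Mapping.single (p j) (Poly_Mapping.lookup m j)) =
      Poly_Mapping.map_key (Hilbert_Choice.inv p) m"
  proof (rule poly_mapping_eqI)
    fix q
    have "(\<Sum>j\<in>Poly_Mapping.keys m. Poly_Mapping.lookup m j when p j = q)
        = (\<Sum>j\<in>Poly_Mapping.keys m. if j = Hilbert_Choice.inv p q then Poly_Mapping.lookup m (Hilbert_Choice.inv p q) else 0)"
      using perm by (intro sum.cong) (auto simp: when_def permutes_inv_eq)
    then show "Poly_Mapping.lookup (\<Sum>j\<in>Poly_Mapping.keys m.
        Poly_Mapping.single (p j) (Poly_Mapping.lookup m j)) q =
        Poly_Mapping.lookup (Poly_Mapping.map_key (Hilbert_Choice.inv p) m) q"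
      using bij by (simp add: lookup_sum lookup_single map_key.rep_eq in_keys_iff)
  qed
  moreover have "(\<Prod>j\<in>Poly_Mapping.keys m. sym_incl (col A j) ^ Poly_Mapping.lookup m j) =
      (\<Prod>j\<in>Poly_Mapping.keys m. Poly_Mapping.single (Poly_Mapping.single (p j) (Poly_Mapping.lookup m j))
        (a j ^ Poly_Mapping.lookup m j))"
    using assms by (intro prod.cong) (auto simp: sym_incl_col single_power[unfolded One_nat_def])
  moreover have "(\<Prod>j\<in>Poly_Mapping.keys m. a j ^ Poly_Mapping.lookup m j) =
      (\<Prod>j<n. a j ^ Poly_Mapping.lookup m j)"
    using assms by (intro prod.mono_neutral_left) (auto simp: in_keys_iff)
  ultimately show ?thesis
    by (simp add: sym_act_single prod_single)
qed

text \<open>Permuting the variables preserves the degree; this provides the stability of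
  \<open>Sym_power n r\<close> required for the trace.\<close>

lemma map_key_exponents:
  assumes "m \<in> exponents n r"
  shows "Poly_Mapping.map_key (Hilbert_Choice.inv p) m \<in> exponents n r"
proof -
  have inj: "inj (Hilbert_Choice.inv p)" and inv: "Hilbert_Choice.inv p permutes {..<n}"
    using permutes_inv[OF perm] permutes_inj by auto
  have "(\<Sum>i<n. Poly_Mapping.lookup m (Hilbert_Choice.inv p i)) = (\<Sum>i<n. Poly_Mapping.lookup m i)"
    using sum.permute[OF inv, of "Poly_Mapping.lookup m"] by (simp add: o_def)
  moreover have "Poly_Mapping.keys (Poly_Mapping.map_key (Hilbert_Choice.inv p) m) \<subseteq> {..<n}"
    using assms permutes_in_image[OF inv] inj by (auto simp: exponents_def keys_map_key)
  ultimately show ?thesis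
    using assms inj by (simp add: exponents_altdef map_key.rep_eq)
qed

text \<open>The image of a monomial has at most one term, so the diagonal entry at \<open>m\<close>
  is zero unless the permuted exponent vector is \<open>m\<close> itself, which means invariance
  under \<open>p\<close>.\<close>

lemma sym_char_eq:
  "sym_char n r A = (\<Sum>m | m \<in> exponents n r \<and>
     (\<forall>i. Poly_Mapping.lookup m (p i) = Poly_Mapping.lookup m i).
       \<Prod>j<n. a j ^ Poly_Mapping.lookup m j)"
proof -
  have act: "sym_act A (monomial m) =
    Poly_Mapping.single (Poly_Mapping.map_key (Hilbert_Choice.inv p) m) (\<Prod>j<n. a j ^ Poly_Mapping.lookup m j)"
    if "m \<in> exponents n r" for m
    using that by (intro sym_act_monomial) (auto simp: exponents_def)
  have inj: "inj (Hilbert_Choice.inv p)"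
    using permutes_inv[OF perm] permutes_inj by auto
  have fixed: "Poly_Mapping.map_key (Hilbert_Choice.inv p) m = m \<longleftrightarrow>
      (\<forall>i. Poly_Mapping.lookup m (p i) = Poly_Mapping.lookup m i)" for m :: "nat \<Rightarrow>\<^sub>0 nat"
  proof -
    have "Poly_Mapping.map_key (Hilbert_Choice.inv p) m = m \<longleftrightarrow>
        (\<forall>i. Poly_Mapping.lookup m (Hilbert_Choice.inv p i) = Poly_Mapping.lookup m i)"
      using inj by (auto simp: poly_mapping_eq_iff map_key.rep_eq fun_eq_iff)
    also have "\<dots> \<longleftrightarrow> (\<forall>i. Poly_Mapping.lookup m (p i) = Poly_Mapping.lookup m i)"
      using permutes_inverses[OF perm] by metis
    finally show ?thesis .
  qed
  have "sym_char n r A =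
      (\<Sum>m\<in>exponents n r. Poly_Mapping.lookup (sym_act A (monomial m)) m)"
  proof (rule sym_char_eq_sum_lookup)
    fix m assume m: "m \<in> exponents n r"
    show "sym_act A (monomial m) \<in> Sym_power n r"
      unfolding act[OF m] using map_key_exponents[OF m]
      by (auto simp: Sym_power_def exponents_def)
  qed
  also have "\<dots> = (\<Sum>m\<in>exponents n r.
      if \<forall>i. Poly_Mapping.lookup m (p i) = Poly_Mapping.lookup m i
      then \<Prod>j<n. a j ^ Poly_Mapping.lookup m j else 0)"
    unfolding fixed[symmetric] by (intro sum.cong) (auto simp: act lookup_single)
  also have "\<dots> = (\<Sum>m | m \<in> exponents n r \<and>
     (\<forall>i. Poly_Mapping.lookup m (p i) = Poly_Mapping.lookup m i).
       \<Prod>j<n. a j ^ Poly_Mapping.lookup m j)"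
    using finite_exponents by (simp add: sum.inter_filter)
  finally show ?thesis .
qed

section \<open>Cycles and invariant exponent vectors\<close>

definition cycles :: "nat set set" where "cycles = orbit p ` {..<n}"

lemma orbit_eq: "y \<in> orbit p x \<Longrightarrow> orbit p y = orbit p x"
  by (meson cyclic_on_orbit' orbit_cyclic_eq3 permutation_p)

lemma self_in_orbit: "x \<in> orbit p x"
  by (rule permutation_self_in_orbit[OF permutation_p])

text \<open>Orbits are equivalence classes, so the fibre of \<open>orbit p\<close> over a cycle is
  that cycle. Such fibres occur when \<open>sum.image_gen\<close> groups a sum by cycles.\<close>

lemma fiber_orbit:
  assumes "c \<in> cycles"
  shows "{j. j \<in> {..<n} \<and> orbit p j = c} = c"
  using assms permutes_orbit_subset[OF perm] orbit_eq self_in_orbit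
  by (fastforce simp: cycles_def)

lemma finite_cycle:
  assumes "c \<in> cycles"
  shows "finite c" "c \<noteq> {}"
  using assms finite_orbit[OF self_in_orbit] self_in_orbit by (auto simp: cycles_def)

lemma sum_cycles: "(\<Sum>j<n. f j) = (\<Sum>c\<in>cycles. \<Sum>j\<in>c. f j)" for f :: "nat \<Rightarrow> nat"
  using sum.image_gen[of "{..<n}" f "orbit p"] by (simp add: fiber_orbit[simplified] flip: cycles_def)

lemma prod_cycles: "(\<Prod>j<n. f j) = (\<Prod>c\<in>cycles. \<Prod>j\<in>c. f j)" for f :: "nat \<Rightarrow> complex"
  using prod.image_gen[of "{..<n}" f "orbit p"] by (simp add: fiber_orbit[simplified] flip: cycles_def)

lemma orbit_Min:
  assumes "c \<in> cycles"
  shows "orbit p (Min c) = c" "Min c < n"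
proof -
  have "Min c \<in> {j. j \<in> {..<n} \<and> orbit p j = c}"
    using Min_in[OF finite_cycle[OF assms]] fiber_orbit[OF assms] by simp
  then show "orbit p (Min c) = c" "Min c < n" by auto
qed

lemma orbit_of_element: "c \<in> cycles \<Longrightarrow> j \<in> c \<Longrightarrow> orbit p j = c \<and> j < n"
  using fiber_orbit[of c] by auto

lemma constant_on_orbit:
  assumes "\<And>i. f (p i) = f i" "y \<in> orbit p x"
  shows "f y = f x"
  using assms(2) by induction (simp_all add: assms(1))

text \<open>An exponent vector is invariant under \<open>p\<close> exactly if it is constant on each
  cycle, so the surviving monomials correspond to assignments of one exponent to each cycle.\<close>

lemma sym_char_eq_weighted_exponents:
  "sym_char n r A = (\<Sum>u\<in>weighted_exponents cycles card r. \<Prod>c\<in>cycles. (\<Prod>j\<in>c. a j) ^ u c)"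
proof -
  define m :: "(nat set \<Rightarrow> nat) \<Rightarrow> nat \<Rightarrow>\<^sub>0 nat" where
    "m u = (\<Sum>j<n. Poly_Mapping.single j (u (orbit p j)))" for u
  have m: "Poly_Mapping.lookup (m u) j = (if j < n then u (orbit p j) else 0)" for u j
    by (simp add: m_def lookup_sum lookup_single when_def)
  \<comment> \<open>The inverse of \<open>m\<close> reads the exponent at the minimum of the cycle;
    the value 0 elsewhere is what \<open>weighted_exponents\<close> demands.\<close>
  define e :: "(nat \<Rightarrow>\<^sub>0 nat) \<Rightarrow> nat set \<Rightarrow> nat" where
    "e x c = (if c \<in> cycles then Poly_Mapping.lookup x (Min c) else 0)" for x c
  have keys_m: "Poly_Mapping.keys (m u) \<subseteq> {..<n}" for u
    by (auto simp: in_keys_iff m split: if_splits)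
  have m_inv: "Poly_Mapping.lookup (m u) (p i) = Poly_Mapping.lookup (m u) i" for u i
  proof (cases "i < n")
    case True
    then show ?thesis by (simp add: m p_less permutation_orbit_step[OF permutation_p])
  next
    case False
    then show ?thesis using permutes_not_in[OF perm, of i] by simp
  qed
  \<comment> \<open>All \<open>card c\<close> variables of a cycle \<open>c\<close> carry the
    exponent \<open>u c\<close>.\<close>
  have deg: "(\<Sum>c\<in>cycles. card c * u c) = (\<Sum>j<n. Poly_Mapping.lookup (m u) j)" for u
    unfolding sum_cycles using orbit_of_element by (intro sum.cong) (simp_all add: m)
  have wt: "(\<Prod>c\<in>cycles. (\<Prod>j\<in>c. a j) ^ u c) = (\<Prod>j<n. a j ^ Poly_Mapping.lookup (m u) j)" for u
    unfolding prod_cycles using orbit_of_element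
    by (intro prod.cong) (simp_all add: m prod_power_distrib)
  have m_e: "m (e x) = x" if "Poly_Mapping.keys x \<subseteq> {..<n}"
    "\<And>i. Poly_Mapping.lookup x (p i) = Poly_Mapping.lookup x i" for x
  proof (rule poly_mapping_eqI)
    fix j
    show "Poly_Mapping.lookup (m (e x)) j = Poly_Mapping.lookup x j"
    proof (cases "j < n")
      case True
      then have c: "orbit p j \<in> cycles" by (simp add: cycles_def)
      have "Min (orbit p j) \<in> orbit p j" by (rule Min_in[OF finite_cycle[OF c]])
      then have "Poly_Mapping.lookup x (Min (orbit p j)) = Poly_Mapping.lookup x j"
        using that(2) by (rule constant_on_orbit[rotated])
      then show ?thesis using True c by (simp add: m e_def)
    next
      case False
      then show ?thesis using that(1) by (auto simp: m in_keys_iff subset_iff)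
    qed
  qed
  have e_m: "e (m u) = u" if "\<And>c. c \<notin> cycles \<Longrightarrow> u c = 0" for u
    using that orbit_Min by (auto simp: e_def m)
  show ?thesis
    unfolding sym_char_eq
  proof (rule sum.reindex_bij_witness[of _ m e])
    fix x assume x: "x \<in> {x \<in> exponents n r. \<forall>i. Poly_Mapping.lookup x (p i) = Poly_Mapping.lookup x i}"
    then show eq: "m (e x) = x" by (intro m_e) (auto simp: exponents_def)
    show "e x \<in> weighted_exponents cycles card r"
      using x by (simp add: weighted_exponents_def deg eq exponents_altdef) (simp add: e_def)
    show "(\<Prod>c\<in>cycles. (\<Prod>j\<in>c. a j) ^ e x c) = (\<Prod>j<n. a j ^ Poly_Mapping.lookup x j)"
      by (simp add: wt eq)
  next
    fix u assume u: "u \<in> weighted_exponents cycles card r"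
    then show "e (m u) = u" by (intro e_m) (auto simp: weighted_exponents_def)
    show "m u \<in> {x \<in> exponents n r. \<forall>i. Poly_Mapping.lookup x (p i) = Poly_Mapping.lookup x i}"
      using u keys_m m_inv by (simp add: exponents_altdef weighted_exponents_def deg)
  qed
qed

lemma sym_char_generating_function:
  "Abs_fps (\<lambda>r. sym_char n r A) *
    (\<Prod>c\<in>cycles. 1 - fps_const (\<Prod>j\<in>c. a j) * fps_X ^ card c) = 1"
  unfolding sym_char_eq_weighted_exponents
  \<comment> \<open>Cycles are finite and nonempty, hence have positive length.\<close>
  by (rule fps_weighted_exponents) (use finite_cycle in \<open>auto simp: cycles_def card_gt_0_iff\<close>)

end

section \<open>From the group and its cycle lists to the formula\<close>

text \<open>Since \<open>underlying_perm\<close> is a definite description, existence and uniqueness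
  of the permutation have to be shown: the column condition yields the map, the row condition its
  injectivity.\<close>

lemma gen_sym_group_monomial_matrix:
  assumes "A \<in> gen_sym_group k n"
  shows "monomial_matrix n A (underlying_perm A)"
proof -
  have A: "A \<in> carrier_mat n n"
    and row: "\<And>i. i < n \<Longrightarrow> \<exists>!j. j < n \<and> A $$ (i, j) \<noteq> 0"
    and col: "\<And>j. j < n \<Longrightarrow> \<exists>!i. i < n \<and> A $$ (i, j) \<noteq> 0"
    using assms by (auto simp: gen_sym_group_def)
  let ?P = "\<lambda>p. p permutes {..<dim_row A} \<and>
     permutation_mat (dim_row A) p = map_mat (\<lambda>z. if z = 0 then 0 else 1) A"
  have mat_iff: "permutation_mat n p = map_mat (\<lambda>z. if z = 0 then 0 else 1) A \<longleftrightarrow>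
      (\<forall>i<n. \<forall>j<n. i = p j \<longleftrightarrow> A $$ (i, j) \<noteq> 0)" for p
    using A by (auto simp: permutation_mat_def mat_eq_iff split: if_splits)
  \<comment> \<open>From \<open>n\<close> on the map is the identity, as \<open>permutes\<close>
    requires.\<close>
  define p where "p j = (if j < n then THE i. i < n \<and> A $$ (i, j) \<noteq> 0 else j)" for j
  have p: "p j < n \<and> A $$ (p j, j) \<noteq> 0" if "j < n" for j
    unfolding p_def using theI'[OF col[OF that]] that by simp
  have p_eq: "i = p j \<longleftrightarrow> A $$ (i, j) \<noteq> 0" if "i < n" "j < n" for i j
    using col[OF that(2)] p[OF that(2)] that(1) by auto
  have "inj_on p {..<n}"
  proof (rule inj_onI)
    fix i j assume "i \<in> {..<n}" "j \<in> {..<n}" "p i = p j"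
    \<comment> \<open>Row \<open>p i\<close> has a single nonzero entry, and both columns
      \<open>i\<close> and \<open>j\<close> have a nonzero entry in it.\<close>
    then show "i = j" using p[of i] p[of j] row[of "p i"] by auto
  qed
  moreover from this have "p ` {..<n} = {..<n}"
    using p by (intro card_subset_eq) (auto simp: card_image)
  ultimately have perm: "p permutes {..<n}"
    by (intro bij_imp_permutes) (auto simp: bij_betw_def p_def)
  have "?P (underlying_perm A)"
    unfolding underlying_perm_def
  proof (rule theI[where P = ?P and a = p])
    show "?P p" using A perm p_eq by (auto simp: mat_iff)
    fix q assume q: "?P q"
    show "q = p"
    proof
      fix j
      show "q j = p j"
      proof (cases "j < n")
        case True
        then have "p j = q j" using q A p[OF True] by (auto simp: mat_iff)
        then show ?thesis by simp
      next
        case False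
        then show ?thesis
          using q A permutes_not_in[OF perm, of j] permutes_not_in[of q "{..<n}" j] by simp
      qed
    qed
  qed
  then show ?thesis
    using A by unfold_locales (auto simp: mat_iff)
qed

text \<open>For a product over cycles the order of the list is immaterial; what matters is that each
  cycle is listed exactly once. The filter keeps one index per cycle, its minimum.\<close>

lemma (in monomial_matrix) cycle_supports:
  assumes "p = underlying_perm A"
  shows "distinct (cycle_supports A)" "set (cycle_supports A) = cycles"
proof -
  have dim: "dim_row A = n" using carrier by simp
  have "inj_on (orbit p) {i. i = Min (orbit p i)}"
    by (rule inj_on_inverseI[of _ Min]) simp
  then show "distinct (cycle_supports A)"
    by (auto simp: cycle_supports_def distinct_map assms elim: inj_on_subset)
  have "set (cycle_supports A) = orbit p ` {i. i < n \<and> i = Min (orbit p i)}"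
    by (auto simp: cycle_supports_def assms dim)
  also have "\<dots> = cycles"
  proof (intro equalityI subsetI)
    fix c assume "c \<in> cycles"
    then show "c \<in> orbit p ` {i. i < n \<and> i = Min (orbit p i)}"
      using orbit_Min by (intro image_eqI[of _ _ "Min c"]) auto
  qed (auto simp: cycles_def)
  finally show "set (cycle_supports A) = cycles" .
qed

theorem mainTheorem7:
  fixes n k :: nat and \<sigma> :: "complex mat"
  assumes "n \<ge> 1" and "k \<ge> 1" and "\<sigma> \<in> gen_sym_group k n"
  shows "Abs_fps (\<lambda>r. sym_char n r \<sigma>) =
    1 / (\<Prod>i<length (cycle_type \<sigma>).
          1 - fps_const (cycle_products \<sigma> ! i) * fps_X ^ (cycle_type \<sigma> ! i))"
proof -
  interpret monomial_matrix n \<sigma> "underlying_perm \<sigma>"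
    by (rule gen_sym_group_monomial_matrix[OF assms(3)])
  let ?g = "\<lambda>c. 1 - fps_const (\<Prod>j\<in>c. a j) * fps_X ^ card c"
  let ?P = "\<Prod>i<length (cycle_type \<sigma>).
          1 - fps_const (cycle_products \<sigma> ! i) * fps_X ^ (cycle_type \<sigma> ! i)"
  have "?P = (\<Prod>i<length (cycle_supports \<sigma>). ?g (cycle_supports \<sigma> ! i))"
    by (intro prod.cong) (auto simp: cycle_type_def cycle_products_def a_def)
  also have "\<dots> = (\<Prod>c\<in>cycles. ?g c)"
    by (rule prod.reindex_bij_betw)
      (use bij_betw_nth[of "cycle_supports \<sigma>"] cycle_supports in auto)
  finally have "Abs_fps (\<lambda>r. sym_char n r \<sigma>) * ?P = 1"
    using sym_char_generating_function by simp
  \<comment> \<open>As \<open>?P\<close> is nonzero, writing the numerator 1 as the series times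
    \<open>?P\<close> and cancelling gives the quotient.\<close>
  moreover from this have "?P \<noteq> 0" by (metis mult_zero_right zero_neq_one)
  ultimately show ?thesis
    using nonzero_mult_div_cancel_right[of ?P "Abs_fps (\<lambda>r. sym_char n r \<sigma>)"] by simp
qed

end
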